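(* Let $\mathsf{S}_\alpha$ be a horizontal strip of $\mathbb{C}$ and let $T$ be a densely defined operator on a complex Hilbert space $\mathcal{H}$ with numerical range $\mathfrak{n}_T\subseteq\mathsf{S}_\alpha$. Then there exist unique symmetric operators $B\in\mathcal{B}(\mathcal{H})$ and $S$ such that $D(S)=D(T)$ and $$T=S+iB.$$ Moreover, 1. $D(T)\subseteq D(T^* )$; 2. $S=\frac12(T+T^* )$ and $B_{|D(T)}=\frac{1}{2i}(T-T^* )$.
   Context: $\mathcal{H}$ is a complex Hilbert space with inner product $\langle\cdot|\cdot\rangle$ and norm $\|\cdot\|$. An operator $T$ on $\mathcal{H}$ is a linear map from a linear subspace $D(T)\subseteq\mathcal{H}$ to $\mathcal{H}$. $\mathcal{B}(\mathcal{H})$ is the set of bounded operators defined on the whole of $\mathcal{H}$. The numerical range of $T$ is $\mathfrak{n}_T:=\{\langle T\xi|\xi\rangle:\xi\in D(T),\|\xi\|=1\}$. An operator $T$ is symmetric if it is densely defined and $\mathfrak{n}_T\subseteq\mathbb{R}$ (equivalently $T\subseteq T^*$). Sums of operators are defined on the intersection of the domains; $B_{|D(T)}$ is the restriction of $B$ to $D(T)$. For $\alpha\ge0$, a horizontal strip $\mathsf{S}_\alpha$ is a subset of $\mathbb{C}$ with $\{\lambda\in\mathbb{C}:|\Im\lambda|<\alpha\}\subseteq\mathsf{S}_\alpha\subseteq\{\lambda\in\mathbb{C}:|\Im\lambda|\le\alpha\}$. *)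

theory Defs
  imports "HOL-Analysis.Analysis"
begin

text \<open>Complex Hilbert spaces. The inner product is linear in its first argument. The last axiom
  says at once that it is positive definite and that it induces the norm.\<close>

class complex_inner = real_normed_vector +
  fixes scaleC :: "complex \<Rightarrow> 'a \<Rightarrow> 'a"  (infixr \<open>*\<^sub>C\<close> 75)
    and cinner :: "'a \<Rightarrow> 'a \<Rightarrow> complex"
  assumes scaleC_add_right: "c *\<^sub>C (x + y) = c *\<^sub>C x + c *\<^sub>C y"
    and scaleC_add_left: "(c + d) *\<^sub>C x = c *\<^sub>C x + d *\<^sub>C x"
    and scaleC_scaleC: "c *\<^sub>C d *\<^sub>C x = (c * d) *\<^sub>C x"
    and scaleR_scaleC: "r *\<^sub>R x = complex_of_real r *\<^sub>C x"
    and cinner_add_left: "cinner (x + y) z = cinner x z + cinner y z"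
    and cinner_scaleC_left: "cinner (c *\<^sub>C x) y = c * cinner x y"
    and cinner_commute: "cinner x y = cnj (cinner y x)"
    and cinner_self: "cinner x x = complex_of_real ((norm x)\<^sup>2)"

class chilbert_space = complex_inner + complete_space

lemma scaleC_one: "1 *\<^sub>C x = (x::'a::complex_inner)"
  using scaleR_scaleC[of 1 x] by simp

global_interpretation complex_vector: vector_space "scaleC :: complex \<Rightarrow> 'a \<Rightarrow> 'a::complex_inner"
  by unfold_locales
    (simp_all add: scaleC_add_right scaleC_add_left scaleC_scaleC scaleC_one)

text \<open>A not necessarily everywhere defined operator is a partial map \<open>T :: 'a \<rightharpoonup> 'a\<close> with domain
  \<open>dom T\<close>, so that equality of operators includes equality of their domains.\<close>

definition operator :: "('a::complex_inner \<rightharpoonup> 'a) \<Rightarrow> bool" where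
  "operator T \<longleftrightarrow> complex_vector.subspace (dom T) \<and>
     (\<forall>\<xi>\<in>dom T. \<forall>\<eta>\<in>dom T. the (T (\<xi> + \<eta>)) = the (T \<xi>) + the (T \<eta>)) \<and>
     (\<forall>c. \<forall>\<xi>\<in>dom T. the (T (c *\<^sub>C \<xi>)) = c *\<^sub>C the (T \<xi>))"

definition densely_defined :: "('a::complex_inner \<rightharpoonup> 'a) \<Rightarrow> bool" where
  "densely_defined T \<longleftrightarrow> closure (dom T) = UNIV"

definition bounded_operator :: "('a::complex_inner \<rightharpoonup> 'a) \<Rightarrow> bool" where
  "bounded_operator B \<longleftrightarrow> operator B \<and> dom B = UNIV \<and> bounded_linear (\<lambda>\<xi>. the (B \<xi>))"

definition numerical_range :: "('a::complex_inner \<rightharpoonup> 'a) \<Rightarrow> complex set" where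
  "numerical_range T = {cinner (the (T \<xi>)) \<xi> | \<xi>. \<xi> \<in> dom T \<and> norm \<xi> = 1}"

definition symmetric_operator :: "('a::complex_inner \<rightharpoonup> 'a) \<Rightarrow> bool" where
  "symmetric_operator T \<longleftrightarrow> operator T \<and> densely_defined T \<and> numerical_range T \<subseteq> \<real>"

definition op_add :: "('a::complex_inner \<rightharpoonup> 'a) \<Rightarrow> ('a \<rightharpoonup> 'a) \<Rightarrow> ('a \<rightharpoonup> 'a)"  (infixl \<open>\<oplus>\<^sub>o\<close> 65) where
  "S \<oplus>\<^sub>o T = (\<lambda>\<xi>. if \<xi> \<in> dom S \<inter> dom T then Some (the (S \<xi>) + the (T \<xi>)) else None)"

definition op_diff :: "('a::complex_inner \<rightharpoonup> 'a) \<Rightarrow> ('a \<rightharpoonup> 'a) \<Rightarrow> ('a \<rightharpoonup> 'a)"  (infixl \<open>\<ominus>\<^sub>o\<close> 65) where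
  "S \<ominus>\<^sub>o T = (\<lambda>\<xi>. if \<xi> \<in> dom S \<inter> dom T then Some (the (S \<xi>) - the (T \<xi>)) else None)"

definition op_scale :: "complex \<Rightarrow> ('a::complex_inner \<rightharpoonup> 'a) \<Rightarrow> ('a \<rightharpoonup> 'a)"  (infixr \<open>\<odot>\<^sub>o\<close> 75) where
  "c \<odot>\<^sub>o T = (\<lambda>\<xi>. if \<xi> \<in> dom T then Some (c *\<^sub>C the (T \<xi>)) else None)"

text \<open>The vector selected by \<open>THE\<close> is unique when \<open>T\<close> is densely defined; the adjoint is
  meaningful only in that case.\<close>

definition adjoint_op :: "('a::complex_inner \<rightharpoonup> 'a) \<Rightarrow> ('a \<rightharpoonup> 'a)" where
  "adjoint_op T = (\<lambda>\<eta>.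
     if \<exists>\<zeta>. \<forall>\<xi>\<in>dom T. cinner (the (T \<xi>)) \<eta> = cinner \<xi> \<zeta>
     then Some (THE \<zeta>. \<forall>\<xi>\<in>dom T. cinner (the (T \<xi>)) \<eta> = cinner \<xi> \<zeta>)
     else None)"

definition horizontal_strip :: "real \<Rightarrow> complex set \<Rightarrow> bool" where
  "horizontal_strip \<alpha> A \<longleftrightarrow> 0 \<le> \<alpha> \<and>
     {z. \<bar>Im z\<bar> < \<alpha>} \<subseteq> A \<and> A \<subseteq> {z. \<bar>Im z\<bar> \<le> \<alpha>}"

end

theory Submission
  imports Defs
begin

text \<open>
  If \<open>T = S + i B\<close> with \<open>S\<close> and \<open>B\<close> symmetric, then \<open>cinner (B x) y\<close> has to be the
  ``imaginary part'' of the form of \<open>T\<close>, namely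
  \[ h(x, y) = \frac{1}{2i} (\langle T x | y \rangle - \langle x | T y \rangle), \]
  a Hermitian form on the domain of \<open>T\<close> with \<open>h x x = Im (cinner (T x) x)\<close>. Since the numerical
  range lies in the strip, this quadratic form is bounded by \<open>\<alpha>\<close>, and by
  polarization a Hermitian form is as bounded as its quadratic form (\<open>hermitian_form_bound\<close>). So
  \<open>h\<close>, unlike \<open>T\<close> itself, is bounded, and the Riesz representation theorem together with the
  density of the domain gives a bounded operator \<open>B\<close> on the whole space that represents it
  (\<open>bounded_hermitian_form_represented\<close>). Subtracting \<open>i B\<close> from \<open>T\<close> removes the imaginary part of
  the quadratic form, so \<open>S = T - i B\<close> is symmetric.

  Conversely, symmetry of \<open>S\<close> and \<open>B\<close> in any decomposition \<open>T = S + i B\<close> shows that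
  \<open>S - i B\<close> is the restriction of \<open>T\<^sup>*\<close> to the domain of \<open>T\<close> (\<open>adjoint_of_decomposition\<close>). This gives the
  inclusion of the domains, and taking the sum and the difference of \<open>T\<close> and \<open>T\<^sup>*\<close> yields the
  formulas for \<open>S\<close> and \<open>B\<close>. Uniqueness is a consequence of these formulas: they determine \<open>S\<close>, and they
  determine \<open>B\<close> on a dense subspace and hence, by continuity, everywhere.
\<close>

section \<open>Geometry of complex inner product spaces\<close>

lemma cinner_add_right: "cinner x (y + z) = cinner x y + cinner x z"
  by (metis cinner_add_left cinner_commute complex_cnj_add)

lemma cinner_scaleC_right: "cinner x (c *\<^sub>C y) = cnj c * cinner x y"
  by (metis cinner_commute cinner_scaleC_left complex_cnj_mult)

text \<open>Not a rewrite rule: in a vector space the simplifier turns \<open>(-1) *\<^sub>C x\<close> back into \<open>- x\<close>.\<close>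

lemma minus_eq_scaleC: "- x = (-1) *\<^sub>C (x::'a::complex_inner)"
  using scaleR_scaleC[of "-1" x] by simp

lemma cinner_minus_left: "cinner (- x) y = - cinner x y"
  by (metis minus_eq_scaleC cinner_scaleC_left mult_minus1)

lemma cinner_minus_right: "cinner x (- y) = - cinner x y"
  using cinner_scaleC_right[of x "-1" y] by (simp flip: minus_eq_scaleC)

lemma cinner_diff_left: "cinner (x - y) z = cinner x z - cinner y z"
  using cinner_add_left[of x "- y" z] by (simp add: cinner_minus_left)

lemma cinner_diff_right: "cinner z (x - y) = cinner z x - cinner z y"
  using cinner_add_right[of z x "- y"] by (simp add: cinner_minus_right)

lemma Re_cinner_commute: "Re (cinner x y) = Re (cinner y x)"
  by (metis cinner_commute cnj.simps(1))

lemma norm_scaleC: "norm (c *\<^sub>C (x::'a::complex_inner)) = cmod c * norm x"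
proof -
  have "complex_of_real ((norm (c *\<^sub>C x))\<^sup>2) = complex_of_real ((cmod c * norm x)\<^sup>2)"
    unfolding cinner_self[symmetric] cinner_scaleC_left cinner_scaleC_right
    by (simp add: cinner_self power_mult_distrib complex_norm_square del: of_real_power)
  then have "(norm (c *\<^sub>C x))\<^sup>2 = (cmod c * norm x)\<^sup>2"
    using of_real_eq_iff by blast
  then show ?thesis
    by (simp add: power2_eq_iff_nonneg)
qed

lemma norm_add_square:
  "(norm (x + y))\<^sup>2 = (norm x)\<^sup>2 + 2 * Re (cinner x y) + (norm (y::'a::complex_inner))\<^sup>2"
proof -
  have "Re (cinner (x + y) (x + y)) = Re (cinner x x) + 2 * Re (cinner x y) + Re (cinner y y)"
    by (simp add: cinner_add_left cinner_add_right Re_cinner_commute[of y x])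
  then show ?thesis by (simp add: cinner_self)
qed

lemma parallelogram_law:
  "(norm (x + y))\<^sup>2 + (norm (x - y))\<^sup>2 = 2 * (norm x)\<^sup>2 + 2 * (norm (y::'a::complex_inner))\<^sup>2"
  using norm_add_square[of x y] norm_add_square[of x "- y"] by (simp add: cinner_minus_right)

text \<open>Polarization expresses \<open>4 * Re (h u v)\<close> by the values of the quadratic form at \<open>u + v\<close> and
  \<open>u - v\<close>, and the parallelogram law turns the bounds on these into \<open>4 * \<alpha>\<close> for unit vectors. Normalizing both
  arguments and rotating one of them by the phase of \<open>h x y\<close> turns the real part into the modulus, so
  the constant \<open>\<alpha>\<close> is kept.\<close>

lemma hermitian_form_bound:
  fixes h :: "'a::complex_inner \<Rightarrow> 'a \<Rightarrow> complex"
  assumes D: "complex_vector.subspace D"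
    and add: "\<And>x y z. x \<in> D \<Longrightarrow> y \<in> D \<Longrightarrow> z \<in> D \<Longrightarrow> h (x + y) z = h x z + h y z"
    and scale: "\<And>c x y. x \<in> D \<Longrightarrow> y \<in> D \<Longrightarrow> h (c *\<^sub>C x) y = c * h x y"
    and herm: "\<And>x y. x \<in> D \<Longrightarrow> y \<in> D \<Longrightarrow> h x y = cnj (h y x)"
    and bound: "\<And>x. x \<in> D \<Longrightarrow> \<bar>Re (h x x)\<bar> \<le> \<alpha> * (norm x)\<^sup>2"
    and x: "x \<in> D" and y: "y \<in> D"
  shows "cmod (h x y) \<le> \<alpha> * norm x * norm y"
proof -
  note sub = complex_vector.subspace_add[OF D] complex_vector.subspace_diff[OF D]
    complex_vector.subspace_scale[OF D]
  have scaleR: "h u (c *\<^sub>C v) = cnj c * h u v" if "u \<in> D" "v \<in> D" for u v c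
    using herm[of u "c *\<^sub>C v"] herm[of u v] scale[of v u c] that sub(3) by simp
  have addR: "h u (v + w) = h u v + h u w" if "u \<in> D" "v \<in> D" "w \<in> D" for u v w
    using herm[of u "v + w"] herm[of u v] herm[of u w] add[of v w u] that sub(1) by simp
  have unit: "Re (h u v) \<le> \<alpha>" if uv: "u \<in> D" "v \<in> D" "norm u = 1" "norm v = 1" for u v
  proof -
    have mD: "- v \<in> D"
      using sub(3)[OF uv(2), of "-1"] by (simp flip: minus_eq_scaleC)
    have minus: "h (- v) w = - h v w" "h w (- v) = - h w v" if "w \<in> D" for w
      using scale[OF uv(2) that, of "-1"] scaleR[OF that uv(2), of "-1"]
      by (simp_all flip: minus_eq_scaleC)
    have p: "Re (h (u + v) (u + v)) = Re (h u u) + Re (h v v) + 2 * Re (h u v)"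
      using herm[of v u] uv sub by (simp add: add addR)
    have q: "Re (h (u - v) (u - v)) = Re (h u u) + Re (h v v) - 2 * Re (h u v)"
    proof -
      have "h (u + - v) (u + - v) = h u u + h v v - h u v - h v u"
        using uv(1,2) mD sub(1) by (simp add: add addR minus del: add_uminus_conv_diff)
      then show ?thesis using herm[of v u] uv by simp
    qed
    have "4 * Re (h u v) = Re (h (u + v) (u + v)) - Re (h (u - v) (u - v))"
      using p q by simp
    also have "\<dots> \<le> \<alpha> * (norm (u + v))\<^sup>2 + \<alpha> * (norm (u - v))\<^sup>2"
      using bound[of "u + v"] bound[of "u - v"] uv sub by fastforce
    also have "\<dots> = 4 * \<alpha>"
      using parallelogram_law[of u v] uv by (simp flip: distrib_left)
    finally show ?thesis by simp
  qed
  show ?thesis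
  proof (cases "h x y = 0 \<or> x = 0 \<or> y = 0")
    case True
    have z: "h 0 y = 0"
      using scale[OF x y, of 0] by simp
    have z': "h x 0 = 0"
      using scaleR[OF x y, of 0] by simp
    have "0 \<le> \<alpha> * norm x * norm y"
    proof (cases "x = 0")
      case False
      have "0 \<le> \<alpha> * (norm x)\<^sup>2" using bound[OF x] by linarith
      then have "0 \<le> \<alpha>" using False by (simp add: zero_le_mult_iff)
      then show ?thesis by simp
    qed simp
    then show ?thesis using True z z' by auto
  next
    case False
    \<comment> \<open>The scalar \<open>c\<close> also rotates \<open>x\<close> so that the form becomes real and nonnegative.\<close>
    define c where "c = cnj (sgn (h x y)) / complex_of_real (norm x)"
    define d where "d = 1 / complex_of_real (norm y)"
    have "norm (c *\<^sub>C x) = 1" "norm (d *\<^sub>C y) = 1"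
      using False by (auto simp: norm_scaleC c_def d_def norm_divide norm_sgn)
    then have "Re (h (c *\<^sub>C x) (d *\<^sub>C y)) \<le> \<alpha>"
      using unit sub(3) x y by blast
    moreover have "h (c *\<^sub>C x) (d *\<^sub>C y) = complex_of_real (cmod (h x y) / (norm x * norm y))"
    proof -
      have "cnj (sgn (h x y)) * h x y = complex_of_real (cmod (h x y))"
        using False by (simp add: sgn_eq mult.commute flip: complex_norm_square)
           (simp add: power2_eq_square)
      then show ?thesis
        using x y sub(3) by (simp add: scale scaleR c_def d_def)
    qed
    ultimately have "cmod (h x y) / (norm x * norm y) \<le> \<alpha>" by simp
    then show ?thesis using False by (simp add: field_simps)
  qed
qed

text \<open>The inner product is itself a Hermitian form, and its quadratic form is bounded by \<open>1\<close>.\<close>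

lemma Cauchy_Schwarz: "cmod (cinner x y) \<le> norm x * norm (y::'a::complex_inner)"
proof -
  have "cmod (cinner x y) \<le> 1 * norm x * norm y"
  proof (rule hermitian_form_bound[of UNIV])
    show "cinner u v = cnj (cinner v u)" for u v :: 'a by (rule cinner_commute)
  qed (simp_all add: cinner_add_left cinner_scaleC_left cinner_self)
  then show ?thesis by simp
qed

lemma bounded_bilinear_cinner:
  "bounded_bilinear (cinner :: 'a::complex_inner \<Rightarrow> 'a \<Rightarrow> complex)"
proof
  show "\<exists>K. \<forall>a b. norm (cinner a (b::'a)) \<le> norm a * norm b * K"
    using Cauchy_Schwarz by (intro exI[of _ 1]) auto
qed (simp_all add: cinner_add_left cinner_add_right scaleR_scaleC cinner_scaleC_left
    cinner_scaleC_right scaleR_conv_of_real[where 'a = complex])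

text \<open>The bound extends from \<open>D\<close> to all \<open>y\<close> by continuity, and \<open>y = u\<close> then gives the claim.\<close>

lemma norm_le_by_density:
  fixes u :: "'a::complex_inner"
  assumes D: "closure D = UNIV"
    and bound: "\<And>y. y \<in> D \<Longrightarrow> cmod (cinner y u) \<le> C * norm y"
    and C: "0 \<le> C"
  shows "norm u \<le> C"
proof (cases "u = 0")
  case False
  have "closed {y. cmod (cinner y u) \<le> C * norm y}"
    by (intro closed_Collect_le continuous_intros
        bounded_bilinear.continuous_on[OF bounded_bilinear_cinner])
  then have "u \<in> {y. cmod (cinner y u) \<le> C * norm y}"
    using closure_minimal[of D "{y. cmod (cinner y u) \<le> C * norm y}"] D bound by blast
  then have "norm u * norm u \<le> C * norm u"
    by (simp add: cinner_self norm_power power2_eq_square norm_mult)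
  then show ?thesis using False by simp
qed (use C in simp)

lemma eq_by_density:
  fixes u v :: "'a::complex_inner"
  assumes D: "closure D = UNIV"
    and eq: "\<And>y. y \<in> D \<Longrightarrow> cinner y u = cinner y v"
  shows "u = v"
  using norm_le_by_density[OF D, of "u - v" 0] eq by (simp add: cinner_diff_right)

section \<open>Representation of bounded functionals and forms\<close>

lemma nonneg_quadratic_imp_linear_zero:
  fixes a b :: real
  assumes "\<And>t. 0 \<le> 2 * t * a + t\<^sup>2 * b" and b: "0 \<le> b"
  shows "a = 0"
proof (rule ccontr)
  assume "a \<noteq> 0"
  define t where "t = - a / (b + 1)"
  have a: "a = - t * (b + 1)" using b by (simp add: t_def field_simps)
  have "t \<noteq> 0" using \<open>a \<noteq> 0\<close> a by auto
  have "2 * t * a + t\<^sup>2 * b = - (t\<^sup>2 * (b + 2))"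
    unfolding a by (simp add: power2_eq_square algebra_simps)
  moreover have "0 < t\<^sup>2 * (b + 2)" using \<open>t \<noteq> 0\<close> b by simp
  ultimately show False using assms(1)[of t] by linarith
qed

text \<open>The representing vector minimizes \<open>J x = (norm x)\<^sup>2 - 2 * Re (f x)\<close>, which for \<open>x\<close> in \<open>D\<close>
  is, up to a constant, the squared distance from \<open>x\<close> to that vector. The subspace need not be closed: a minimizing sequence
  in \<open>D\<close> is Cauchy by the parallelogram law, and its limit, which may lie outside \<open>D\<close>,
  still satisfies the first-order condition in every direction of \<open>D\<close>. So a functional on a dense
  domain is represented without being extended first.\<close>

lemma Riesz_representation_on_subspace:
  fixes f :: "'a::chilbert_space \<Rightarrow> complex"
  assumes D: "complex_vector.subspace D"
    and add: "\<And>x y. x \<in> D \<Longrightarrow> y \<in> D \<Longrightarrow> f (x + y) = f x + f y"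
    and scale: "\<And>c x. x \<in> D \<Longrightarrow> f (c *\<^sub>C x) = c * f x"
    and bound: "\<And>x. x \<in> D \<Longrightarrow> cmod (f x) \<le> C * norm x"
  shows "\<exists>\<zeta>. \<forall>x\<in>D. f x = cinner x \<zeta>"
proof -
  note sub = complex_vector.subspace_add[OF D] complex_vector.subspace_diff[OF D]
    complex_vector.subspace_scale[OF D]
  define J where "J x = (norm x)\<^sup>2 - 2 * Re (f x)" for x
  define m where "m = Inf (J ` D)"
  have bdd: "bdd_below (J ` D)"
  proof (rule bdd_belowI2)
    fix x assume "x \<in> D"
    then have "Re (f x) \<le> C * norm x"
      using bound complex_Re_le_cmod order_trans by blast
    moreover have "0 \<le> (norm x - C)\<^sup>2" by simp
    ultimately show "- C\<^sup>2 \<le> J x"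
      unfolding J_def power2_diff by (simp add: mult.commute)
  qed
  have m_le: "m \<le> J x" if "x \<in> D" for x
    unfolding m_def using bdd that by (simp add: cInf_lower)
  have "\<exists>x\<in>D. J x < m + inverse (real (Suc n))" for n
  proof -
    have "J ` D \<noteq> {}" using complex_vector.subspace_0[OF D] by blast
    then show ?thesis
      using cInf_lessD[of "J ` D" "m + inverse (real (Suc n))"] unfolding m_def by auto
  qed
  then obtain x where xD: "\<And>n. x n \<in> D" and Jx: "\<And>n. J (x n) < m + inverse (real (Suc n))"
    by metis
  have fR: "f (r *\<^sub>R y) = complex_of_real r * f y" if "y \<in> D" for r y
    using scale[OF that] by (simp add: scaleR_scaleC)
  have RD: "r *\<^sub>R y \<in> D" if "y \<in> D" for r y
    using sub(3)[OF that] by (simp add: scaleR_scaleC)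
  \<comment> \<open>Near-minimizers are close to each other, since \<open>J\<close> is at least \<open>m\<close> at their midpoint.\<close>
  have gap: "(norm (y - z))\<^sup>2 \<le> 2 * (J y - m) + 2 * (J z - m)" if "y \<in> D" "z \<in> D" for y z
  proof -
    have "4 * J ((1 / 2) *\<^sub>R (y + z)) = (norm (y + z))\<^sup>2 - 4 * Re (f y) - 4 * Re (f z)"
      using that sub(1) by (simp add: J_def fR add power_divide add_divide_distrib del: scaleR_add_right)
    moreover have "m \<le> J ((1 / 2) *\<^sub>R (y + z))"
      by (rule m_le[OF RD[OF sub(1)[OF that]]])
    ultimately show ?thesis
      using parallelogram_law[of y z] by (simp add: J_def)
  qed
  have "Cauchy x"
  proof (rule metric_CauchyI)
    fix e :: real assume e: "0 < e"
    obtain N where N: "inverse (real (Suc N)) < e\<^sup>2 / 4"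
      using e reals_Archimedean[of "e\<^sup>2 / 4"] by auto
    have J_N: "J (x n) - m < e\<^sup>2 / 4" if "N \<le> n" for n
    proof -
      have "inverse (real (Suc n)) \<le> inverse (real (Suc N))" using that by simp
      then show ?thesis using N Jx[of n] by linarith
    qed
    have "dist (x k) (x n) < e" if "N \<le> k" "N \<le> n" for k n
    proof -
      have "(norm (x k - x n))\<^sup>2 < e\<^sup>2"
        using gap[OF xD xD, of k n] J_N[OF that(1)] J_N[OF that(2)]
        by (simp add: field_simps)
      then show ?thesis
        using e by (simp add: dist_norm power2_less_imp_less)
    qed
    then show "\<exists>M. \<forall>m\<ge>M. \<forall>n\<ge>M. dist (x m) (x n) < e" by blast
  qed
  then obtain \<zeta> where lim: "x \<longlonglongrightarrow> \<zeta>"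
    using Cauchy_convergent convergentD by blast
  have Jlim: "(\<lambda>n. J (x n)) \<longlonglongrightarrow> m"
  proof (rule tendsto_sandwich[where f = "\<lambda>_. m" and h = "\<lambda>n. m + inverse (real (Suc n))"])
    show "(\<lambda>n. m + inverse (real (Suc n))) \<longlonglongrightarrow> m"
      using tendsto_add[OF tendsto_const LIMSEQ_inverse_real_of_nat, of m] by simp
    show "\<forall>\<^sub>F n in sequentially. J (x n) \<le> m + inverse (real (Suc n))"
      using less_imp_le[OF Jx] by (rule always_eventually[OF allI])
  qed (use m_le xD in auto)
  have Re_eq: "Re (f y) = Re (cinner y \<zeta>)" if y: "y \<in> D" for y
  proof -
    \<comment> \<open>First variation: the infimum cannot be undercut by moving along \<open>y\<close>.\<close>
    have "0 \<le> 2 * t * (Re (cinner y \<zeta>) - Re (f y)) + t\<^sup>2 * (norm y)\<^sup>2" for t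
    proof -
      have expand: "J (x n + t *\<^sub>R y)
          = J (x n) + (2 * t * (Re (cinner y (x n)) - Re (f y)) + t\<^sup>2 * (norm y)\<^sup>2)" for n
      proof -
        have "cinner (x n) (t *\<^sub>R y) = complex_of_real t * cinner (x n) y"
          by (simp only: scaleR_scaleC cinner_scaleC_right complex_cnj_complex_of_real)
        then have "Re (cinner (x n) (t *\<^sub>R y)) = t * Re (cinner y (x n))"
          using Re_cinner_commute[of y "x n"] by simp
        then show ?thesis
          unfolding J_def norm_add_square add[OF xD RD[OF y]] fR[OF y]
          by (simp add: power_mult_distrib algebra_simps)
      qed
      have "(\<lambda>n. J (x n) + (2 * t * (Re (cinner y (x n)) - Re (f y)) + t\<^sup>2 * (norm y)\<^sup>2))
          \<longlonglongrightarrow> m + (2 * t * (Re (cinner y \<zeta>) - Re (f y)) + t\<^sup>2 * (norm y)\<^sup>2)"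
        by (intro tendsto_intros Jlim
            bounded_bilinear.tendsto[OF bounded_bilinear_cinner] lim)
      moreover have "m \<le> J (x n + t *\<^sub>R y)" for n
        using m_le sub(1) xD RD[OF y] by blast
      ultimately have "m \<le> m + (2 * t * (Re (cinner y \<zeta>) - Re (f y)) + t\<^sup>2 * (norm y)\<^sup>2)"
        unfolding expand by (intro LIMSEQ_le_const) auto
      then show ?thesis by simp
    qed
    then show ?thesis
      using nonneg_quadratic_imp_linear_zero[of "Re (cinner y \<zeta>) - Re (f y)" "(norm y)\<^sup>2"]
      by simp
  qed
  have "f y = cinner y \<zeta>" if y: "y \<in> D" for y
  proof (rule complex_eqI)
    show "Re (f y) = Re (cinner y \<zeta>)" by (rule Re_eq[OF y])
    show "Im (f y) = Im (cinner y \<zeta>)"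
      using Re_eq[OF sub(3)[OF y, of \<i>]] y by (simp add: scale cinner_scaleC_left)
  qed
  then show ?thesis by blast
qed

text \<open>The Riesz representation is applied twice. It first represents \<open>h\<close> on \<open>D\<close> by an operator
  \<open>b\<^sub>0\<close> defined only there. The operator \<open>b\<close> is then constructed on the whole space as the adjoint of
  \<open>b\<^sub>0\<close>. As \<open>h\<close> is Hermitian, \<open>b\<close> agrees with \<open>b\<^sub>0\<close> on \<open>D\<close>, so it is the extension of \<open>b\<^sub>0\<close> by
  continuity; linearity and the bound are read off from the defining identity.\<close>

lemma bounded_hermitian_form_represented:
  fixes h :: "'a::chilbert_space \<Rightarrow> 'a \<Rightarrow> complex"
  assumes D: "complex_vector.subspace D" and dense: "closure D = UNIV"
    and add: "\<And>x y z. x \<in> D \<Longrightarrow> y \<in> D \<Longrightarrow> z \<in> D \<Longrightarrow> h (x + y) z = h x z + h y z"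
    and scale: "\<And>c x y. x \<in> D \<Longrightarrow> y \<in> D \<Longrightarrow> h (c *\<^sub>C x) y = c * h x y"
    and herm: "\<And>x y. x \<in> D \<Longrightarrow> y \<in> D \<Longrightarrow> h x y = cnj (h y x)"
    and bound: "\<And>x y. x \<in> D \<Longrightarrow> y \<in> D \<Longrightarrow> cmod (h x y) \<le> C * norm x * norm y"
    and C: "0 \<le> C"
  shows "\<exists>b. bounded_linear b \<and> (\<forall>c x. b (c *\<^sub>C x) = c *\<^sub>C b x) \<and>
           (\<forall>x\<in>D. \<forall>y\<in>D. h x y = cinner (b x) y)"
proof -
  note sub = complex_vector.subspace_add[OF D] complex_vector.subspace_scale[OF D]
  have "\<forall>x\<in>D. \<exists>\<zeta>. \<forall>y\<in>D. h y x = cinner y \<zeta>"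
  proof
    fix x assume x: "x \<in> D"
    show "\<exists>\<zeta>. \<forall>y\<in>D. h y x = cinner y \<zeta>"
      by (rule Riesz_representation_on_subspace[OF D, where C = "C * norm x"])
        (use add scale bound x in \<open>simp_all add: mult.commute mult.left_commute\<close>)
  qed
  then obtain b\<^sub>0 where b\<^sub>0: "\<And>x y. x \<in> D \<Longrightarrow> y \<in> D \<Longrightarrow> h y x = cinner y (b\<^sub>0 x)"
    by metis
  have b\<^sub>0': "h x y = cinner (b\<^sub>0 x) y" if "x \<in> D" "y \<in> D" for x y
    using b\<^sub>0[OF that] herm[OF that] cinner_commute by metis
  have b\<^sub>0_add: "b\<^sub>0 (x + y) = b\<^sub>0 x + b\<^sub>0 y" if "x \<in> D" "y \<in> D" for x y
  proof (rule eq_by_density[OF dense])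
    fix z assume z: "z \<in> D"
    show "cinner z (b\<^sub>0 (x + y)) = cinner z (b\<^sub>0 x + b\<^sub>0 y)"
      using herm[of z "x + y"] herm[of z x] herm[of z y] add[of x y z] that z sub(1)
      by (simp add: cinner_add_right flip: b\<^sub>0)
  qed
  have b\<^sub>0_scale: "b\<^sub>0 (c *\<^sub>C x) = c *\<^sub>C b\<^sub>0 x" if "x \<in> D" for c x
  proof (rule eq_by_density[OF dense])
    fix z assume z: "z \<in> D"
    show "cinner z (b\<^sub>0 (c *\<^sub>C x)) = cinner z (c *\<^sub>C b\<^sub>0 x)"
      using herm[of z "c *\<^sub>C x"] herm[of z x] scale[of x z c] that z sub(2)
      by (simp add: cinner_scaleC_right flip: b\<^sub>0)
  qed
  have b\<^sub>0_bound: "norm (b\<^sub>0 x) \<le> C * norm x" if "x \<in> D" for x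
    by (rule norm_le_by_density[OF dense])
      (use bound that C in \<open>simp_all add: mult.commute mult.left_commute flip: b\<^sub>0\<close>)
  have functional_bound: "cmod (cinner (b\<^sub>0 y) x) \<le> (C * norm x) * norm y" if "y \<in> D" for x y
  proof -
    have "cmod (cinner (b\<^sub>0 y) x) \<le> norm (b\<^sub>0 y) * norm x" by (rule Cauchy_Schwarz)
    also have "\<dots> \<le> (C * norm y) * norm x"
      by (intro mult_right_mono b\<^sub>0_bound that) simp
    finally show ?thesis by (simp add: mult_ac)
  qed
  have "\<forall>x. \<exists>\<zeta>. \<forall>y\<in>D. cinner (b\<^sub>0 y) x = cinner y \<zeta>"
  proof
    fix x
    show "\<exists>\<zeta>. \<forall>y\<in>D. cinner (b\<^sub>0 y) x = cinner y \<zeta>"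
      by (rule Riesz_representation_on_subspace[OF D, where C = "C * norm x"])
        (use functional_bound in \<open>simp_all add: b\<^sub>0_add b\<^sub>0_scale cinner_add_left cinner_scaleC_left\<close>)
  qed
  then obtain b where b: "\<And>x y. y \<in> D \<Longrightarrow> cinner (b\<^sub>0 y) x = cinner y (b x)"
    by metis
  have b_add: "b (x + y) = b x + b y" for x y
    by (rule eq_by_density[OF dense]) (simp add: cinner_add_right flip: b)
  have b_scale: "b (c *\<^sub>C x) = c *\<^sub>C b x" for c x
    by (rule eq_by_density[OF dense]) (simp add: cinner_scaleC_right flip: b)
  have b_bound: "norm (b x) \<le> norm x * C" for x
    by (rule norm_le_by_density[OF dense])
      (use functional_bound C in \<open>simp_all add: mult_ac flip: b\<close>)
  have "bounded_linear b"
    by (rule bounded_linear_intro[where K = C]) (simp_all add: b_add b_scale b_bound scaleR_scaleC)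
  moreover have "h x y = cinner (b x) y" if "x \<in> D" "y \<in> D" for x y
    using b[of y x] b\<^sub>0'[OF that(2) that(1)] herm[OF that] that cinner_commute by metis
  ultimately show ?thesis using b_scale by blast
qed

section \<open>Numerical range and symmetric operators\<close>

text \<open>Homogeneity carries information on unit vectors over to all vectors. The factor \<open>z\<close> is arbitrary
  for \<open>x = 0\<close>, as the numerical range is empty in the zero space.\<close>

lemma numerical_range_scaled:
  assumes T: "operator T" and x: "x \<in> dom T"
  shows "\<exists>z. (x \<noteq> 0 \<longrightarrow> z \<in> numerical_range T) \<and>
           cinner (the (T x)) x = complex_of_real ((norm x)\<^sup>2) * z"
proof (cases "x = 0")
  case True
  then show ?thesis using cinner_scaleC_right[of _ 0] by (intro exI[of _ 0]) simp
next
  case False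
  define u where "u = complex_of_real (1 / norm x) *\<^sub>C x"
  have u: "u \<in> dom T" "norm u = 1"
    using T x False complex_vector.subspace_scale unfolding operator_def u_def
    by (blast, simp add: norm_scaleC norm_divide)
  have "x = complex_of_real (norm x) *\<^sub>C u"
    using False by (simp add: u_def scaleC_scaleC scaleC_one flip: of_real_mult)
  then have "cinner (the (T x)) x = complex_of_real ((norm x)\<^sup>2) * cinner (the (T u)) u"
    using T u(1) unfolding operator_def
    by (metis (no_types, lifting) cinner_scaleC_left cinner_scaleC_right complex_cnj_complex_of_real
        mult.assoc of_real_power power2_eq_square)
  then show ?thesis using u numerical_range_def by blast
qed

text \<open>Polarization: reality of the form at \<open>x + y\<close> compares the imaginary parts of \<open>cinner (t x) y\<close>
  and \<open>cinner (t y) x\<close>, and reality at \<open>x + \<i> *\<^sub>C y\<close> compares their real parts.\<close>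

lemma real_form_imp_symmetric:
  fixes t :: "'a::complex_inner \<Rightarrow> 'a"
  assumes D: "complex_vector.subspace D"
    and add: "\<And>x y. x \<in> D \<Longrightarrow> y \<in> D \<Longrightarrow> t (x + y) = t x + t y"
    and scale: "\<And>c x. x \<in> D \<Longrightarrow> t (c *\<^sub>C x) = c *\<^sub>C t x"
    and real: "\<And>x. x \<in> D \<Longrightarrow> Im (cinner (t x) x) = 0"
    and x: "x \<in> D" and y: "y \<in> D"
  shows "cinner (t x) y = cinner x (t y)"
proof -
  have *: "Im (cinner (t x) z) + Im (cinner (t z) x) = 0" if z: "z \<in> D" for z
    using real[OF complex_vector.subspace_add[OF D x z]] real[OF x] real[OF z] x z
    by (simp add: add cinner_add_left cinner_add_right)
  have iy: "\<i> *\<^sub>C y \<in> D" by (rule complex_vector.subspace_scale[OF D y])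
  have "cinner (t x) y = cnj (cinner (t y) x)"
    using *[OF y] *[OF iy] y
    by (intro complex_eqI) (simp_all add: scale cinner_scaleC_left cinner_scaleC_right)
  then show ?thesis using cinner_commute by metis
qed

lemma symmetric_operator_iff_Im:
  "symmetric_operator S \<longleftrightarrow> operator S \<and> densely_defined S \<and>
     (\<forall>x\<in>dom S. Im (cinner (the (S x)) x) = 0)"
proof (cases "operator S")
  case True
  have "numerical_range S \<subseteq> \<real> \<longleftrightarrow> (\<forall>x\<in>dom S. Im (cinner (the (S x)) x) = 0)"
  proof
    assume real: "numerical_range S \<subseteq> \<real>"
    show "\<forall>x\<in>dom S. Im (cinner (the (S x)) x) = 0"
    proof
      fix x assume "x \<in> dom S"
      then obtain z where "x \<noteq> 0 \<longrightarrow> z \<in> numerical_range S"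
          "cinner (the (S x)) x = complex_of_real ((norm x)\<^sup>2) * z"
        using numerical_range_scaled[OF True] by blast
      then show "Im (cinner (the (S x)) x) = 0"
        using real by (cases "x = 0") (auto simp: complex_is_Real_iff simp flip: of_real_power)
    qed
  qed (unfold numerical_range_def subset_iff complex_is_Real_iff, blast)
  then show ?thesis by (simp add: symmetric_operator_def)
qed (simp add: symmetric_operator_def)

lemma symmetric_operator_cinner:
  assumes "symmetric_operator S" "x \<in> dom S" "y \<in> dom S"
  shows "cinner (the (S x)) y = cinner x (the (S y))"
  by (rule real_form_imp_symmetric[where D = "dom S"])
    (use assms in \<open>auto simp: symmetric_operator_iff_Im operator_def\<close>)

section \<open>Sums of operators and the adjoint\<close>

lemma op_add_scale_eq_iff:
  assumes "dom B = UNIV" "dom S = dom T"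
  shows "T = S \<oplus>\<^sub>o c \<odot>\<^sub>o B \<longleftrightarrow> (\<forall>x\<in>dom T. the (T x) = the (S x) + c *\<^sub>C the (B x))"
proof -
  have "(S \<oplus>\<^sub>o c \<odot>\<^sub>o B) x = (if x \<in> dom T then Some (the (S x) + c *\<^sub>C the (B x)) else None)" for x
    using assms by (auto simp: op_add_def op_scale_def dom_def)
  then show ?thesis by (auto simp: fun_eq_iff dom_def split: if_splits)
qed

lemma adjoint_op_eqI:
  assumes "densely_defined T"
    and "\<And>x. x \<in> dom T \<Longrightarrow> cinner (the (T x)) y = cinner x z"
  shows "adjoint_op T y = Some z"
proof -
  have "(THE z. \<forall>x\<in>dom T. cinner (the (T x)) y = cinner x z) = z"
    using assms eq_by_density[of "dom T"] unfolding densely_defined_def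
    by (intro the_equality) auto
  then show ?thesis using assms(2) unfolding adjoint_op_def by auto
qed

text \<open>Moving \<open>S\<close> and \<open>B\<close> to the other side conjugates the coefficient \<open>\<i>\<close>, so \<open>S - i B\<close> is a formal
  adjoint of \<open>T\<close> on the domain of \<open>T\<close>.\<close>

lemma adjoint_of_decomposition:
  assumes T: "densely_defined T"
    and B: "symmetric_operator B" "dom B = UNIV" and S: "symmetric_operator S" "dom S = dom T"
    and eq: "T = S \<oplus>\<^sub>o \<i> \<odot>\<^sub>o B"
    and y: "y \<in> dom T"
  shows "adjoint_op T y = Some (the (S y) - \<i> *\<^sub>C the (B y))"
proof (rule adjoint_op_eqI[OF T])
  fix x assume x: "x \<in> dom T"
  have "the (T x) = the (S x) + \<i> *\<^sub>C the (B x)"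
    using op_add_scale_eq_iff[OF B(2) S(2)] eq x by blast
  then show "cinner (the (T x)) y = cinner x (the (S y) - \<i> *\<^sub>C the (B y))"
    using symmetric_operator_cinner[OF S(1), of x y] symmetric_operator_cinner[OF B(1), of x y] x y B S
    by (simp add: cinner_add_left cinner_scaleC_left cinner_diff_right cinner_scaleC_right)
qed

lemma decomposition_formulas:
  assumes T: "densely_defined T"
    and B: "symmetric_operator B" "dom B = UNIV" and S: "symmetric_operator S" "dom S = dom T"
    and eq: "T = S \<oplus>\<^sub>o \<i> \<odot>\<^sub>o B"
  shows "S = (1 / 2) \<odot>\<^sub>o (T \<oplus>\<^sub>o adjoint_op T)"
    and "B |` dom T = (1 / (2 * \<i>)) \<odot>\<^sub>o (T \<ominus>\<^sub>o adjoint_op T)"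
proof -
  note adj = adjoint_of_decomposition[OF assms]
  have Tx: "the (T x) = the (S x) + \<i> *\<^sub>C the (B x)" if "x \<in> dom T" for x
    using op_add_scale_eq_iff[OF B(2) S(2)] eq that by blast
  have domA: "x \<in> dom (adjoint_op T)" if "x \<in> dom T" for x
    using adj[OF that] by blast
  have double: "u + u = 2 *\<^sub>C u" for u :: 'a
    using scaleC_add_left[of 1 1 u] by (simp add: scaleC_one)
  show "S = (1 / 2) \<odot>\<^sub>o (T \<oplus>\<^sub>o adjoint_op T)"
  proof
    fix x
    show "S x = ((1 / 2) \<odot>\<^sub>o (T \<oplus>\<^sub>o adjoint_op T)) x"
    proof (cases "x \<in> dom T")
      case True
      then have "((1 / 2) \<odot>\<^sub>o (T \<oplus>\<^sub>o adjoint_op T)) x = Some ((1 / 2) *\<^sub>C (the (S x) + the (S x)))"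
        using domA[OF True] adj[OF True] Tx[OF True]
        by (simp add: op_scale_def op_add_def dom_def)
      moreover have "S x = Some (the (S x))" using True S(2) by (metis domD option.sel)
      ultimately show ?thesis by (simp add: double scaleC_scaleC scaleC_one)
    next
      case False
      then have "x \<notin> dom S" using S(2) by simp
      then show ?thesis using False by (simp add: op_scale_def op_add_def domIff)
    qed
  qed
  show "B |` dom T = (1 / (2 * \<i>)) \<odot>\<^sub>o (T \<ominus>\<^sub>o adjoint_op T)"
  proof
    fix x
    show "(B |` dom T) x = ((1 / (2 * \<i>)) \<odot>\<^sub>o (T \<ominus>\<^sub>o adjoint_op T)) x"
    proof (cases "x \<in> dom T")
      case True
      then have "((1 / (2 * \<i>)) \<odot>\<^sub>o (T \<ominus>\<^sub>o adjoint_op T)) x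
          = Some ((1 / (2 * \<i>)) *\<^sub>C (\<i> *\<^sub>C the (B x) + \<i> *\<^sub>C the (B x)))"
        using domA[OF True] adj[OF True] Tx[OF True]
        by (simp add: op_scale_def op_diff_def dom_def)
      moreover have "B x = Some (the (B x))" using B(2) by (metis UNIV_I domD option.sel)
      ultimately show ?thesis using True by (simp add: double scaleC_scaleC scaleC_one)
    next
      case False
      then show ?thesis by (simp add: op_scale_def op_diff_def domIff)
    qed
  qed
qed

lemma bounded_operators_eq_on_dense:
  assumes "bounded_operator B" "bounded_operator B'"
    and D: "closure D = UNIV" and eq: "B |` D = B' |` D"
  shows "B = B'"
proof
  fix x
  have cont: "continuous_on UNIV (\<lambda>x. the (B x))" "continuous_on UNIV (\<lambda>x. the (B' x))"
    using assms(1,2) unfolding bounded_operator_def by (auto intro: linear_continuous_on)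
  have "closed {x. the (B x) = the (B' x)}"
    by (intro closed_Collect_eq cont)
  moreover have "D \<subseteq> {x. the (B x) = the (B' x)}"
    using eq by (auto simp: fun_eq_iff restrict_map_def) metis
  ultimately have "the (B x) = the (B' x)"
    using closure_minimal[of D] D by blast
  moreover have "x \<in> dom B" "x \<in> dom B'"
    using assms(1,2) by (simp_all add: bounded_operator_def)
  ultimately show "B x = B' x" by auto
qed

section \<open>Existence and uniqueness of the decomposition\<close>

lemma strip_decomposition_exists:
  fixes T :: "'a::chilbert_space \<rightharpoonup> 'a"
  assumes T: "operator T" and dense: "densely_defined T"
    and strip: "\<And>z. z \<in> numerical_range T \<Longrightarrow> \<bar>Im z\<bar> \<le> \<alpha>" and \<alpha>: "0 \<le> \<alpha>"
  shows "\<exists>B S. bounded_operator B \<and> symmetric_operator B \<and> symmetric_operator S \<and>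
           dom S = dom T \<and> T = S \<oplus>\<^sub>o \<i> \<odot>\<^sub>o B"
proof -
  define D where "D = dom T"
  define t where "t x = the (T x)" for x
  define h where "h x y = (cinner (t x) y - cinner x (t y)) / (2 * \<i>)" for x y
  have D: "complex_vector.subspace D" and D_dense: "closure D = UNIV"
    and t_add: "\<And>x y. x \<in> D \<Longrightarrow> y \<in> D \<Longrightarrow> t (x + y) = t x + t y"
    and t_scale: "\<And>c x. x \<in> D \<Longrightarrow> t (c *\<^sub>C x) = c *\<^sub>C t x"
    using T dense by (simp_all add: operator_def densely_defined_def D_def t_def)
  have h_add: "h (x + y) z = h x z + h y z" if "x \<in> D" "y \<in> D" for x y z
    using that by (simp add: h_def t_add cinner_add_left field_simps)
  have h_scale: "h (c *\<^sub>C x) y = c * h x y" if "x \<in> D" for c x y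
    using that by (simp add: h_def t_scale cinner_scaleC_left field_simps)
  have h_herm: "h x y = cnj (h y x)" for x y
    using cinner_commute[of "t x" y] cinner_commute[of x "t y"]
    by (simp add: h_def field_simps)
  have h_diag: "h x x = complex_of_real (Im (cinner (t x) x))" for x
    using cinner_commute[of x "t x"] by (simp add: h_def complex_eq_iff)
  have h_diag_bound: "\<bar>Re (h x x)\<bar> \<le> \<alpha> * (norm x)\<^sup>2" if xD: "x \<in> D" for x
  proof -
    obtain z where z: "x \<noteq> 0 \<longrightarrow> z \<in> numerical_range T"
        "cinner (t x) x = complex_of_real ((norm x)\<^sup>2) * z"
      using numerical_range_scaled[OF T, of x] xD unfolding D_def t_def by blast
    have "\<bar>Im (cinner (t x) x)\<bar> = (norm x)\<^sup>2 * \<bar>Im z\<bar>"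
      unfolding z(2) by (simp add: abs_mult del: of_real_power)
    also have "\<dots> \<le> (norm x)\<^sup>2 * \<alpha>"
      using z(1) strip by (cases "x = 0") (auto intro: mult_left_mono)
    finally show ?thesis by (simp add: h_diag mult.commute)
  qed
  have h_bound: "cmod (h x y) \<le> \<alpha> * norm x * norm y" if "x \<in> D" "y \<in> D" for x y
    using hermitian_form_bound[OF D, of h \<alpha> x y] h_add h_scale h_herm h_diag_bound that by blast
  have "\<exists>b. bounded_linear b \<and> (\<forall>c x. b (c *\<^sub>C x) = c *\<^sub>C b x) \<and>
      (\<forall>x\<in>D. \<forall>y\<in>D. h x y = cinner (b x) y)"
    by (rule bounded_hermitian_form_represented[OF D D_dense h_add h_scale h_herm h_bound \<alpha>])
  then obtain b where b: "bounded_linear b" "\<And>c x. b (c *\<^sub>C x) = c *\<^sub>C b x"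
      "\<And>x y. x \<in> D \<Longrightarrow> y \<in> D \<Longrightarrow> h x y = cinner (b x) y"
    by blast
  define B where "B x = Some (b x)" for x
  define S where "S x = (if x \<in> D then Some (t x - \<i> *\<^sub>C b x) else None)" for x
  have domB: "dom B = UNIV" and domS: "dom S = dom T"
    by (auto simp: B_def S_def D_def dom_def)
  have B: "operator B"
    unfolding operator_def domB by (simp add: B_def b(2) linear_simps(1)[OF b(1)])
  \<comment> \<open>\<open>h\<close> is real on the diagonal of \<open>D\<close>, and reality of the form of \<open>b\<close> passes to the closure.\<close>
  have "closed {x. Im (cinner (b x) x) = 0}"
    by (intro closed_Collect_eq continuous_intros
        bounded_bilinear.continuous_on[OF bounded_bilinear_cinner] linear_continuous_on b(1))
  moreover have "D \<subseteq> {x. Im (cinner (b x) x) = 0}"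
    using b(3) h_diag by (metis (mono_tags, lifting) Im_complex_of_real mem_Collect_eq subsetI)
  ultimately have "Im (cinner (b x) x) = 0" for x
    using closure_minimal[of D] D_dense by blast
  then have B_symm: "symmetric_operator B"
    using B unfolding symmetric_operator_iff_Im by (simp add: B_def domB densely_defined_def)
  have S: "operator S"
    using D unfolding operator_def domS D_def[symmetric]
    by (auto simp: S_def t_add t_scale b(2) linear_simps(1)[OF b(1)] complex_vector.subspace_add
        complex_vector.subspace_scale complex_vector.scale_right_diff_distrib scaleC_add_right
        scaleC_scaleC mult.commute)
  have "Im (cinner (t x - \<i> *\<^sub>C b x) x) = 0" if "x \<in> D" for x
    using b(3)[OF that that] h_diag[of x]
    by (simp add: cinner_diff_left cinner_scaleC_left flip: b(3)[OF that that])
  then have S_symm: "symmetric_operator S"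
    using S dense unfolding symmetric_operator_iff_Im densely_defined_def domS
    by (simp add: S_def D_def)
  have "T = S \<oplus>\<^sub>o \<i> \<odot>\<^sub>o B"
    unfolding op_add_scale_eq_iff[OF domB domS] by (simp add: S_def B_def D_def t_def)
  then show ?thesis
    using B B_symm S_symm domB domS b(1) unfolding bounded_operator_def
    by (intro exI[of _ B] exI[of _ S]) (simp add: B_def)
qed

theorem lemma5p1:
  fixes T :: "'a::chilbert_space \<rightharpoonup> 'a"
    and \<alpha> :: real
    and S\<^sub>\<alpha> :: "complex set"
  assumes "horizontal_strip \<alpha> S\<^sub>\<alpha>"
    and "operator T"
    and "densely_defined T"
    and "numerical_range T \<subseteq> S\<^sub>\<alpha>"
  shows "(\<exists>!(B, S). bounded_operator B \<and> symmetric_operator B \<and> symmetric_operator S \<and>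
            dom S = dom T \<and> T = S \<oplus>\<^sub>o \<i> \<odot>\<^sub>o B) \<and>
    dom T \<subseteq> dom (adjoint_op T) \<and>
    (\<forall>B S. bounded_operator B \<and> symmetric_operator B \<and> symmetric_operator S \<and>
            dom S = dom T \<and> T = S \<oplus>\<^sub>o \<i> \<odot>\<^sub>o B \<longrightarrow>
       S = (1 / 2) \<odot>\<^sub>o (T \<oplus>\<^sub>o adjoint_op T) \<and>
       B |` dom T = (1 / (2 * \<i>)) \<odot>\<^sub>o (T \<ominus>\<^sub>o adjoint_op T))"
proof -
  define P where "P B S \<longleftrightarrow> bounded_operator B \<and> symmetric_operator B \<and> symmetric_operator S \<and>
            dom S = dom T \<and> T = S \<oplus>\<^sub>o \<i> \<odot>\<^sub>o B" for B S
  have "\<exists>B S. P B S"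
    unfolding P_def
    by (rule strip_decomposition_exists[where \<alpha> = \<alpha>])
      (use assms in \<open>auto simp: horizontal_strip_def\<close>)
  then obtain B S where BS: "P B S" by blast
  have formulas: "S' = (1 / 2) \<odot>\<^sub>o (T \<oplus>\<^sub>o adjoint_op T)"
      "B' |` dom T = (1 / (2 * \<i>)) \<odot>\<^sub>o (T \<ominus>\<^sub>o adjoint_op T)" if "P B' S'" for B' S'
    using decomposition_formulas[OF assms(3), of B' S'] that
    unfolding P_def bounded_operator_def by blast+
  have "B' = B \<and> S' = S" if B'S': "P B' S'" for B' S'
  proof
    have "B' |` dom T = B |` dom T"
      using formulas(2)[OF B'S'] formulas(2)[OF BS] by (rule trans[OF _ sym])
    then show "B' = B"
      using bounded_operators_eq_on_dense B'S' BS assms(3)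
      unfolding P_def densely_defined_def by blast
    show "S' = S"
      using formulas(1)[OF B'S'] formulas(1)[OF BS] by (rule trans[OF _ sym])
  qed
  then have "\<exists>!(B, S). P B S"
    using BS unfolding Ex1_def split_paired_Ex split_paired_All prod.case prod.inject by blast
  moreover have "dom T \<subseteq> dom (adjoint_op T)"
    using adjoint_of_decomposition[OF assms(3), of B S] BS
    unfolding P_def bounded_operator_def by blast
  ultimately show ?thesis
    using formulas unfolding P_def by blast
qed

end
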